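(* Let $\lambda$ be a nonzero real number and let $x,y\in\mathbb{R}$. For every integer $n\ge 0$, \begin{align*} \beta_{n,\lambda}^{(c)}(x,y)&=\sum_{k=0}^{n}\binom{n}{k}\beta_{k,\lambda}C_{n-k,\lambda}(x,y)\\ &=\sum_{k=0}^{[\frac{n}{2}]}\sum_{l=2k}^{n}\binom{n}{l}\lambda^{l-2k}(-1)^{k}y^{2k}S^{(1)}(l,2k)\beta_{n-l,\lambda}(x). \end{align*} Also, for every integer $n\ge 1$, \begin{align*} \beta_{n,\lambda}^{(s)}(x,y)&=\sum_{k=0}^{n}\binom{n}{k}\beta_{k,\lambda}S_{n-k,\lambda}(x,y)\\ &=\sum_{k=0}^{[\frac{n-1}{2}]}\sum_{l=2k+1}^{n}\binom{n}{l}\lambda^{l-2k-1}(-1)^{k}y^{2k+1}S^{(1)}(l,2k+1)\beta_{n-l,\lambda}(x), \end{align*} and $\beta_{0,\lambda}^{(s)}(x,y)=0$.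
   Context: All generating functions are power series in $t$ around $t=0$. For nonzero $\lambda\in\mathbb{R}$ and complex $z$, the degenerate exponential is $e_\lambda^{z}(t)=(1+\lambda t)^{z/\lambda}$, and $e_\lambda(t)=e_\lambda^1(t)$. The degenerate cosine and sine functions are $\cos_\lambda^{(y)}(t)=\frac{e_\lambda^{iy}(t)+e_\lambda^{-iy}(t)}{2}=\cos\left(\frac{y}{\lambda}\log(1+\lambda t)\right)$ and $\sin_\lambda^{(y)}(t)=\frac{e_\lambda^{iy}(t)-e_\lambda^{-iy}(t)}{2i}=\sin\left(\frac{y}{\lambda}\log(1+\lambda t)\right)$, with $i=\sqrt{-1}$. The degenerate Bernoulli polynomials $\beta_{n,\lambda}(x)$ are defined by $\frac{t}{e_\lambda(t)-1}e_\lambda^{x}(t)=\sum_{n=0}^{\infty}\beta_{n,\lambda}(x)\frac{t^n}{n!}$, and $\beta_{n,\lambda}=\beta_{n,\lambda}(0)$. The degenerate cosine-Bernoulli and sine-Bernoulli polynomials are defined by $\frac{t}{e_\lambda(t)-1}e_\lambda^{x}(t)\cos_\lambda^{(y)}(t)=\sum_{n=0}^{\infty}\beta_{n,\lambda}^{(c)}(x,y)\frac{t^n}{n!}$ and $\frac{t}{e_\lambda(t)-1}e_\lambda^{x}(t)\sin_\lambda^{(y)}(t)=\sum_{n=0}^{\infty}\beta_{n,\lambda}^{(s)}(x,y)\frac{t^n}{n!}$. The degenerate cosine-polynomials and sine-polynomials are defined by $e_\lambda^{x}(t)\cos_\lambda^{(y)}(t)=\sum_{n=0}^{\infty}C_{n,\lambda}(x,y)\frac{t^n}{n!}$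 and $e_\lambda^{x}(t)\sin_\lambda^{(y)}(t)=\sum_{n=0}^{\infty}S_{n,\lambda}(x,y)\frac{t^n}{n!}$. The (signed) Stirling numbers of the first kind $S^{(1)}(n,l)$ are defined by $x(x-1)\cdots(x-n+1)=\sum_{l=0}^{n}S^{(1)}(n,l)x^l$ (the empty product being $1$ for $n=0$). $[a]$ denotes the greatest integer $\le a$. *)

theory Defs
  imports "HOL-Complex_Analysis.Complex_Analysis"
begin

text \<open>
  Generating functions are formal power series over the complex numbers; the lemmas below
  identify them with the expansions at 0 of the analytic functions they stand for.
  Only the case \<open>lam \<noteq> 0\<close> is meaningful.
\<close>

definition deg_exp :: "real \<Rightarrow> complex \<Rightarrow> complex fps" where
  "deg_exp lam z =
     fps_compose (fps_binomial (z / of_real lam)) (fps_const (of_real lam) * fps_X)"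

definition deg_cos :: "real \<Rightarrow> real \<Rightarrow> complex fps" where
  "deg_cos lam y =
     (deg_exp lam (\<i> * of_real y) + deg_exp lam (- (\<i> * of_real y))) / fps_const 2"

definition deg_sin :: "real \<Rightarrow> real \<Rightarrow> complex fps" where
  "deg_sin lam y =
     (deg_exp lam (\<i> * of_real y) - deg_exp lam (- (\<i> * of_real y))) / fps_const (2 * \<i>)"

text \<open>
  The divisor has order 1 in \<open>t\<close>, so the division of power series is exact.
\<close>
definition deg_bernoulli_gf :: "real \<Rightarrow> complex fps" where
  "deg_bernoulli_gf lam = fps_X / (deg_exp lam 1 - 1)"

definition egf_coeff :: "complex fps \<Rightarrow> nat \<Rightarrow> complex" where
  "egf_coeff F n = fps_nth F n * fact n"

definition deg_bernoulli_poly :: "nat \<Rightarrow> real \<Rightarrow> real \<Rightarrow> complex" where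
  "deg_bernoulli_poly n lam x =
     egf_coeff (deg_bernoulli_gf lam * deg_exp lam (of_real x)) n"

definition deg_bernoulli :: "nat \<Rightarrow> real \<Rightarrow> complex" where
  "deg_bernoulli n lam = deg_bernoulli_poly n lam 0"

definition deg_cos_bernoulli_poly :: "nat \<Rightarrow> real \<Rightarrow> real \<Rightarrow> real \<Rightarrow> complex" where
  "deg_cos_bernoulli_poly n lam x y =
     egf_coeff (deg_bernoulli_gf lam * deg_exp lam (of_real x) * deg_cos lam y) n"

definition deg_sin_bernoulli_poly :: "nat \<Rightarrow> real \<Rightarrow> real \<Rightarrow> real \<Rightarrow> complex" where
  "deg_sin_bernoulli_poly n lam x y =
     egf_coeff (deg_bernoulli_gf lam * deg_exp lam (of_real x) * deg_sin lam y) n"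

definition deg_cos_poly :: "nat \<Rightarrow> real \<Rightarrow> real \<Rightarrow> real \<Rightarrow> complex" where
  "deg_cos_poly n lam x y = egf_coeff (deg_exp lam (of_real x) * deg_cos lam y) n"

definition deg_sin_poly :: "nat \<Rightarrow> real \<Rightarrow> real \<Rightarrow> real \<Rightarrow> complex" where
  "deg_sin_poly n lam x y = egf_coeff (deg_exp lam (of_real x) * deg_sin lam y) n"

text \<open>
  The library's \<open>stirling\<close> is the unsigned number; this is the signed one.
\<close>
definition stirling1 :: "nat \<Rightarrow> nat \<Rightarrow> int" where
  "stirling1 n l = poly.coeff (\<Prod>i<n. [:- int i, 1:]) l"

lemma stirling1_falling_factorial:
  "(\<Prod>i<n. x - int i) = (\<Sum>l=0..n. stirling1 n l * x ^ l)"
proof -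
  have "degree (\<Prod>i<n. [:- int i, 1:]) = n"
    by (subst degree_prod_eq_sum_degree) auto
  then have "poly (\<Prod>i<n. [:- int i, 1:]) x = (\<Sum>l\<le>n. stirling1 n l * x ^ l)"
    by (simp add: poly_altdef stirling1_def)
  then show ?thesis
    by (simp add: poly_prod atLeast0AtMost)
qed

lemma deg_exp_has_fps_expansion:
  "(\<lambda>t. (1 + of_real lam * t) powr (z / of_real lam)) has_fps_expansion deg_exp lam z"
proof -
  have "(\<lambda>t. of_real lam * t) has_fps_expansion fps_const (of_real lam :: complex) * fps_X"
    by (intro fps_expansion_intros)
  then have "((\<lambda>x. (1 + x) powr (z / of_real lam)) \<circ> (\<lambda>t. of_real lam * t))
      has_fps_expansion deg_exp lam z"
    unfolding deg_exp_def
    by (intro has_fps_expansion_compose has_fps_expansion_binomial_complex) auto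
  then show ?thesis
    by (simp add: o_def)
qed

lemma eventually_nz: "eventually (\<lambda>t. 1 + of_real lam * t \<noteq> (0::complex)) (nhds 0)"
proof -
  have "open {t. 1 + of_real lam * t \<noteq> (0::complex)}"
    by (intro open_Collect_neq continuous_intros)
  then show ?thesis
    using eventually_nhds_in_open[of "{t. 1 + of_real lam * t \<noteq> (0::complex)}" 0] by simp
qed

lemma deg_cos_has_fps_expansion:
  "(\<lambda>t. cos (of_real y / of_real lam * Ln (1 + of_real lam * t))) has_fps_expansion deg_cos lam y"
proof -
  let ?e = "\<lambda>z t. (1 + of_real lam * t) powr (z / of_real lam)"
  have "(\<lambda>t. (?e (\<i> * of_real y) t + ?e (- (\<i> * of_real y)) t) / 2) has_fps_expansion deg_cos lam y"
    unfolding deg_cos_def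
    by (intro has_fps_expansion_divide' has_fps_expansion_add deg_exp_has_fps_expansion
        has_fps_expansion_const) auto
  moreover have "eventually (\<lambda>t. (?e (\<i> * of_real y) t + ?e (- (\<i> * of_real y)) t) / 2 =
      cos (of_real y / of_real lam * Ln (1 + of_real lam * t))) (nhds 0)"
    using eventually_nz[of lam]
    by eventually_elim (simp add: powr_def cos_exp_eq mult_ac)
  ultimately show ?thesis
    by (rule has_fps_expansion_cong[OF _ refl, THEN iffD1, rotated])
qed

lemma deg_sin_has_fps_expansion:
  "(\<lambda>t. sin (of_real y / of_real lam * Ln (1 + of_real lam * t))) has_fps_expansion deg_sin lam y"
proof -
  let ?e = "\<lambda>z t. (1 + of_real lam * t) powr (z / of_real lam)"
  have "(\<lambda>t. (?e (\<i> * of_real y) t - ?e (- (\<i> * of_real y)) t) / (2 * \<i>))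
      has_fps_expansion deg_sin lam y"
    unfolding deg_sin_def
    by (intro has_fps_expansion_divide' has_fps_expansion_diff deg_exp_has_fps_expansion
        has_fps_expansion_const) auto
  moreover have "eventually (\<lambda>t. (?e (\<i> * of_real y) t - ?e (- (\<i> * of_real y)) t) / (2 * \<i>) =
      sin (of_real y / of_real lam * Ln (1 + of_real lam * t))) (nhds 0)"
    using eventually_nz[of lam]
    by eventually_elim (simp add: powr_def sin_exp_eq mult_ac)
  ultimately show ?thesis
    by (rule has_fps_expansion_cong[OF _ refl, THEN iffD1, rotated])
qed

lemma deg_exp_nth: "fps_nth (deg_exp lam z) n = ((z / of_real lam) gchoose n) * of_real lam ^ n"
  unfolding deg_exp_def by (subst fps_compose_linear) (simp add: mult.commute)

lemma deg_bernoulli_gf_mult: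
  assumes "lam \<noteq> 0"
  shows "deg_bernoulli_gf lam * (deg_exp lam 1 - 1) = fps_X"
proof -
  have c: "fps_nth (deg_exp lam 1 - 1) 0 = 0" "fps_nth (deg_exp lam 1 - 1) 1 = 1"
    using assms by (simp_all add: deg_exp_nth)
  have "subdegree (deg_exp lam 1 - 1) = 1"
    by (rule subdegreeI) (use c in auto)
  then have "(deg_exp lam 1 - 1) dvd fps_X"
    using c by (subst fps_dvd_iff) auto
  then show ?thesis
    unfolding deg_bernoulli_gf_def by simp
qed

lemma deg_bernoulli_gf_has_fps_expansion:
  assumes "lam \<noteq> 0"
  shows "(\<lambda>t. if t = 0 then 1 else t / ((1 + of_real lam * t) powr (1 / of_real lam) - 1))
           has_fps_expansion deg_bernoulli_gf lam"
proof -
  have c: "fps_nth (deg_exp lam 1 - 1) 0 = 0" "fps_nth (deg_exp lam 1 - 1) 1 = 1"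
    using assms by (simp_all add: deg_exp_nth)
  then have s: "subdegree (deg_exp lam 1 - 1) = 1"
    by (intro subdegreeI) auto
  show ?thesis
    unfolding deg_bernoulli_gf_def
  proof (rule has_fps_expansion_divide)
    show "(\<lambda>t. t) has_fps_expansion (fps_X :: complex fps)"
      by (rule has_fps_expansion_fps_X)
    show "(\<lambda>t. (1 + of_real lam * t) powr (1 / of_real lam) - 1) has_fps_expansion deg_exp lam 1 - 1"
      by (intro has_fps_expansion_diff deg_exp_has_fps_expansion has_fps_expansion_1)
    show "deg_exp lam 1 - 1 \<noteq> 0"
      using c(2) by force
  qed (use s c in simp_all)
qed

end

theory Submission
  imports Defs
begin

text \<open>
  Exponential generating functions multiply by binomial convolution. Both convolution
  formulas split the same triple product \<open>t / (e(t) - 1) * e^x(t) * cos(t)\<close>, once after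
  the first factor and once before the last; for the second split, the coefficients of \<open>cos\<close> come
  from the expansion \<open>e^z = (\<Sum>l. z^l * (\<Sum>n. S1(n,l) * lam^(n - l) * t^n / n!))\<close> at
  \<open>z = i y\<close> and \<open>z = - i y\<close>, where the terms of odd \<open>l\<close> cancel. The sine is treated alike.
\<close>

lemma egf_coeff_mult:
  "egf_coeff (F * G) n =
     (\<Sum>k=0..n. of_nat (n choose k) * egf_coeff F k * egf_coeff G (n - k))"
  unfolding egf_coeff_def fps_mult_nth sum_distrib_right
  by (intro sum.cong refl) (simp add: binomial_fact field_simps)

text \<open>At \<open>x = 0\<close> this reduces the series behind \<open>deg_bernoulli\<close> to
  the bare factor \<open>deg_bernoulli_gf lam\<close>.\<close>

lemma deg_exp_0 [simp]: "deg_exp lam 0 = 1"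
proof (rule fps_ext)
  show "fps_nth (deg_exp lam 0) n = fps_nth 1 n" for n
    by (cases n) (simp_all add: deg_exp_nth)
qed

text \<open>Moves \<open>stirling1\<close> from integer to complex polynomials: both products obey
  the same coefficient recurrence. Coefficient \<open>Suc l\<close> draws on \<open>l\<close> and
  \<open>Suc l\<close> of the shorter product, so \<open>l\<close> must vary in the
  induction.\<close>

lemma coeff_prod_of_int_stirling1:
  "coeff (\<Prod>i<n. [:- of_nat i, 1 :: complex:]) l = of_int (stirling1 n l)"
proof (induction n arbitrary: l)
  case 0
  show ?case by (simp add: stirling1_def)
next
  case (Suc n)
  then show ?case
    by (cases l) (simp_all add: stirling1_def mult.commute coeff_pCons)
qed

text \<open>The falling factorial is needed at \<open>z / lam\<close>, which is not an
  integer.\<close>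

lemma prod_diff_of_nat_stirling1:
  "(\<Prod>i<n. z - of_nat i) = (\<Sum>l\<le>n. of_int (stirling1 n l) * z ^ l)" for z :: complex
proof -
  have "degree (\<Prod>i<n. [:- of_nat i, 1 :: complex:]) = n"
    by (subst degree_prod_eq_sum_degree) auto
  then have "poly (\<Prod>i<n. [:- of_nat i, 1:]) z = (\<Sum>l\<le>n. of_int (stirling1 n l) * z ^ l)"
    by (simp add: poly_altdef coeff_prod_of_int_stirling1)
  then show ?thesis
    by (simp add: poly_prod)
qed

text \<open>The factor \<open>fact n\<close> turns the generalized binomial coefficient into a
  falling factorial of \<open>z / lam\<close>. Since \<open>l \<le> n\<close> and
  \<open>lam \<noteq> 0\<close>, the powers of \<open>lam\<close> combine to
  \<open>lam ^ (n - l)\<close>.\<close>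

lemma egf_coeff_deg_exp:
  assumes "lam \<noteq> 0"
  shows "egf_coeff (deg_exp lam z) n =
    (\<Sum>l\<le>n. of_real lam ^ (n - l) * of_int (stirling1 n l) * z ^ l)"
proof -
  have "egf_coeff (deg_exp lam z) n = (\<Prod>i<n. z / of_real lam - of_nat i) * of_real lam ^ n"
    by (simp add: egf_coeff_def deg_exp_nth gbinomial_prod_rev atLeast0LessThan)
  also have "\<dots> = (\<Sum>l\<le>n. of_real lam ^ (n - l) * of_int (stirling1 n l) * z ^ l)"
    unfolding prod_diff_of_nat_stirling1 sum_distrib_right
    using assms by (intro sum.cong refl) (simp add: power_diff power_divide)
  finally show ?thesis .
qed

text \<open>Used with \<open>j = 0\<close> for the cosine and \<open>j = 1\<close> for the sine. The
  comprehension as index set is correctly empty for \<open>n = 0\<close>,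
  \<open>j = 1\<close>.\<close>

lemma sum_single_parity:
  fixes f :: "nat \<Rightarrow> 'a :: comm_monoid_add"
  assumes "j < 2" and "\<And>l. l mod 2 \<noteq> j \<Longrightarrow> f l = 0"
  shows "(\<Sum>l\<le>n. f l) = (\<Sum>k | 2 * k + j \<le> n. f (2 * k + j))"
proof -
  have "(\<Sum>k | 2 * k + j \<le> n. f (2 * k + j)) = sum f ((\<lambda>k. 2 * k + j) ` {k. 2 * k + j \<le> n})"
    by (subst sum.reindex) (auto simp: inj_on_def)
  also have "\<dots> = (\<Sum>l\<le>n. f l)"
  proof (rule sum.mono_neutral_left)
    show "\<forall>l\<in>{..n} - (\<lambda>k. 2 * k + j) ` {k. 2 * k + j \<le> n}. f l = 0"
    proof
      fix l assume l: "l \<in> {..n} - (\<lambda>k. 2 * k + j) ` {k. 2 * k + j \<le> n}"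
      have "l mod 2 \<noteq> j"
      proof
        assume "l mod 2 = j"
        then have "l = 2 * (l div 2) + j" by presburger
        with l show False by auto
      qed
      then show "f l = 0" by (rule assms)
    qed
  qed auto
  finally show ?thesis by simp
qed

lemma imaginary_power_even: "(\<i> * z) ^ (2 * k) = (-1) ^ k * z ^ (2 * k)"
  by (simp add: power_mult_distrib power_mult[of \<i>])

lemma egf_coeff_deg_cos:
  assumes "lam \<noteq> 0"
  shows "egf_coeff (deg_cos lam y) n =
    (\<Sum>k | 2 * k \<le> n. of_real lam ^ (n - 2 * k) * (-1) ^ k * of_real y ^ (2 * k) *
       of_int (stirling1 n (2 * k)))"
proof -
  let ?s = "\<lambda>l. of_real lam ^ (n - l) * of_int (stirling1 n l) :: complex"
  let ?f = "\<lambda>l. ?s l * (((\<i> * of_real y) ^ l + (- (\<i> * of_real y)) ^ l) / 2)"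
  have "egf_coeff (deg_cos lam y) n =
      (egf_coeff (deg_exp lam (\<i> * of_real y)) n + egf_coeff (deg_exp lam (- (\<i> * of_real y))) n) / 2"
    unfolding egf_coeff_def deg_cos_def divide_fps_const fps_mult_left_const_nth
    by (simp add: field_simps)
  also have "\<dots> = (\<Sum>l\<le>n. ?f l)"
    unfolding egf_coeff_deg_exp[OF assms] sum.distrib[symmetric] sum_divide_distrib
    by (simp add: ring_distribs mult_ac)
  also have "\<dots> = (\<Sum>k | 2 * k + 0 \<le> n. ?f (2 * k + 0))"
    \<comment> \<open>For odd \<open>l\<close> the two powers are opposite and cancel.\<close>
    by (rule sum_single_parity) (auto simp: power_minus_odd odd_iff_mod_2_eq_one)
  also have "\<dots> = (\<Sum>k | 2 * k \<le> n. of_real lam ^ (n - 2 * k) * (-1) ^ k * of_real y ^ (2 * k) *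
       of_int (stirling1 n (2 * k)))"
    by (simp add: imaginary_power_even) (simp add: mult_ac)
  finally show ?thesis .
qed

lemma egf_coeff_deg_sin:
  assumes "lam \<noteq> 0"
  shows "egf_coeff (deg_sin lam y) n =
    (\<Sum>k | 2 * k + 1 \<le> n. of_real lam ^ (n - 2 * k - 1) * (-1) ^ k * of_real y ^ (2 * k + 1) *
       of_int (stirling1 n (2 * k + 1)))"
proof -
  let ?s = "\<lambda>l. of_real lam ^ (n - l) * of_int (stirling1 n l) :: complex"
  let ?f = "\<lambda>l. ?s l * (((\<i> * of_real y) ^ l - (- (\<i> * of_real y)) ^ l) / (2 * \<i>))"
  have "egf_coeff (deg_sin lam y) n =
      (egf_coeff (deg_exp lam (\<i> * of_real y)) n - egf_coeff (deg_exp lam (- (\<i> * of_real y))) n)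
        / (2 * \<i>)"
    unfolding egf_coeff_def deg_sin_def divide_fps_const fps_mult_left_const_nth
    by (simp add: field_simps)
  also have "\<dots> = (\<Sum>l\<le>n. ?f l)"
    unfolding egf_coeff_deg_exp[OF assms] sum_subtractf[symmetric] sum_divide_distrib
    by (simp add: ring_distribs mult_ac)
  also have "\<dots> = (\<Sum>k | 2 * k + 1 \<le> n. ?f (2 * k + 1))"
    \<comment> \<open>For even \<open>l\<close> the two powers agree and their difference
      vanishes.\<close>
    by (rule sum_single_parity) (auto simp: power_minus_even even_iff_mod_2_eq_zero)
  also have "\<dots> = (\<Sum>k | 2 * k + 1 \<le> n. of_real lam ^ (n - 2 * k - 1) * (-1) ^ k *
       of_real y ^ (2 * k + 1) * of_int (stirling1 n (2 * k + 1)))"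
    \<comment> \<open>An odd power leaves one extra factor \<open>\<i>\<close>, which the
      denominator \<open>2 * \<i>\<close> absorbs.\<close>
    by (simp add: imaginary_power_even) (simp add: mult_ac)
  finally show ?thesis .
qed

lemma sum_swap_triangle:
  fixes f :: "nat \<Rightarrow> nat \<Rightarrow> 'a :: comm_monoid_add"
  shows "(\<Sum>l=0..n. \<Sum>k | 2 * k + j \<le> l. f k l) = (\<Sum>k | 2 * k + j \<le> n. \<Sum>l=2*k+j..n. f k l)"
proof -
  have fin: "finite {k. 2 * k + j \<le> n}"
    by (rule finite_subset[of _ "{..n}"]) auto
  \<comment> \<open>As \<open>l \<le> n\<close>, every \<open>k\<close> that occurs lies in one
    finite set independent of \<open>l\<close>, so the two sums can be exchanged.\<close>
  have "(\<Sum>l=0..n. \<Sum>k | 2 * k + j \<le> l. f k l) =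
      (\<Sum>l\<in>{0..n}. \<Sum>k | k \<in> {k. 2 * k + j \<le> n} \<and> 2 * k + j \<le> l. f k l)"
    by (intro sum.cong) auto
  also have "\<dots> = (\<Sum>k\<in>{k. 2 * k + j \<le> n}. \<Sum>l | l \<in> {0..n} \<and> 2 * k + j \<le> l. f k l)"
    by (rule sum.swap_restrict) (use fin in auto)
  also have "\<dots> = (\<Sum>k | 2 * k + j \<le> n. \<Sum>l=2*k+j..n. f k l)"
    by (intro sum.cong) auto
  finally show ?thesis .
qed

lemma deg_cos_bernoulli_poly_conv:
  "deg_cos_bernoulli_poly n lam x y =
    (\<Sum>k=0..n. of_nat (n choose k) * deg_bernoulli k lam * deg_cos_poly (n - k) lam x y)"
  unfolding deg_cos_bernoulli_poly_def deg_cos_poly_def deg_bernoulli_def deg_bernoulli_poly_def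
  \<comment> \<open>The pattern \<open>_ * _\<close> for the second factor makes the convolution
    split off only the first factor and keeps \<open>deg_exp * deg_cos\<close> whole.\<close>
  by (simp add: mult.assoc egf_coeff_mult[of _ "_ * _"])

lemma deg_sin_bernoulli_poly_conv:
  "deg_sin_bernoulli_poly n lam x y =
    (\<Sum>k=0..n. of_nat (n choose k) * deg_bernoulli k lam * deg_sin_poly (n - k) lam x y)"
  unfolding deg_sin_bernoulli_poly_def deg_sin_poly_def deg_bernoulli_def deg_bernoulli_poly_def
  by (simp add: mult.assoc egf_coeff_mult[of _ "_ * _"])

lemma deg_cos_bernoulli_poly_stirling1:
  assumes "lam \<noteq> 0"
  shows "deg_cos_bernoulli_poly n lam x y =
    (\<Sum>k=0..n div 2. \<Sum>l=2*k..n.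
       of_nat (n choose l) * of_real lam ^ (l - 2*k) * (-1) ^ k * of_real y ^ (2*k) *
       of_int (stirling1 l (2*k)) * deg_bernoulli_poly (n - l) lam x)"
proof -
  have range: "{k. 2 * k \<le> n} = {0..n div 2}" by auto
  \<comment> \<open>With the cosine in front, \<open>l\<close> indexes its coefficients and
    \<open>n - l\<close> those of the Bernoulli factor.\<close>
  have "deg_cos_bernoulli_poly n lam x y =
      egf_coeff (deg_cos lam y * (deg_bernoulli_gf lam * deg_exp lam (of_real x))) n"
    by (simp add: deg_cos_bernoulli_poly_def mult.commute)
  \<comment> \<open>The \<open>+ 0\<close> matches \<open>sum_swap_triangle\<close> at
    \<open>j = 0\<close>.\<close>
  also have "\<dots> = (\<Sum>l=0..n. \<Sum>k | 2 * k + 0 \<le> l.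
       of_nat (n choose l) * of_real lam ^ (l - 2*k) * (-1) ^ k * of_real y ^ (2*k) *
       of_int (stirling1 l (2*k)) * deg_bernoulli_poly (n - l) lam x)"
    unfolding egf_coeff_mult[of "deg_cos lam y"] egf_coeff_deg_cos[OF assms]
      deg_bernoulli_poly_def[symmetric]
    by (simp add: sum_distrib_left sum_distrib_right mult.assoc)
  finally show ?thesis
    unfolding sum_swap_triangle by (simp add: range)
qed

lemma deg_sin_bernoulli_poly_stirling1:
  assumes "lam \<noteq> 0" and "n \<ge> 1"
  shows "deg_sin_bernoulli_poly n lam x y =
    (\<Sum>k=0..(n - 1) div 2. \<Sum>l=2*k+1..n.
       of_nat (n choose l) * of_real lam ^ (l - 2*k - 1) * (-1) ^ k * of_real y ^ (2*k + 1) *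
       of_int (stirling1 l (2*k + 1)) * deg_bernoulli_poly (n - l) lam x)"
proof -
  \<comment> \<open>Here \<open>n \<ge> 1\<close> matters: at \<open>n = 0\<close> the left set is
    empty, while truncated subtraction makes the right one \<open>{0}\<close>.\<close>
  have range: "{k. 2 * k + 1 \<le> n} = {0..(n - 1) div 2}" using assms(2) by auto
  have "deg_sin_bernoulli_poly n lam x y =
      egf_coeff (deg_sin lam y * (deg_bernoulli_gf lam * deg_exp lam (of_real x))) n"
    by (simp add: deg_sin_bernoulli_poly_def mult.commute)
  also have "\<dots> = (\<Sum>l=0..n. \<Sum>k | 2 * k + 1 \<le> l.
       of_nat (n choose l) * of_real lam ^ (l - 2*k - 1) * (-1) ^ k * of_real y ^ (2*k + 1) *
       of_int (stirling1 l (2*k + 1)) * deg_bernoulli_poly (n - l) lam x)"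
    unfolding egf_coeff_mult[of "deg_sin lam y"] egf_coeff_deg_sin[OF assms(1)]
      deg_bernoulli_poly_def[symmetric]
    by (simp add: sum_distrib_left sum_distrib_right mult.assoc)
  finally show ?thesis
    unfolding sum_swap_triangle range .
qed

text \<open>No \<open>k\<close> satisfies \<open>2 * k + 1 \<le> 0\<close>, so the sine series has
  no constant term, and neither has any multiple of it.\<close>

lemma deg_sin_bernoulli_poly_0:
  assumes "lam \<noteq> 0"
  shows "deg_sin_bernoulli_poly 0 lam x y = 0"
proof -
  have "egf_coeff (deg_sin lam y) 0 = 0"
    by (simp add: egf_coeff_deg_sin[OF assms])
  then show ?thesis
    unfolding deg_sin_bernoulli_poly_def egf_coeff_mult[of _ "deg_sin lam y"] by simp
qed

theorem theorem3p1:
  fixes lam x y :: real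
  assumes "lam \<noteq> 0"
  shows
    "(\<forall>n.
        deg_cos_bernoulli_poly n lam x y =
          (\<Sum>k=0..n. of_nat (n choose k) * deg_bernoulli k lam * deg_cos_poly (n - k) lam x y) \<and>
        (\<Sum>k=0..n. of_nat (n choose k) * deg_bernoulli k lam * deg_cos_poly (n - k) lam x y) =
          (\<Sum>k=0..n div 2. \<Sum>l=2*k..n.
             of_nat (n choose l) * of_real lam ^ (l - 2*k) * (-1) ^ k * of_real y ^ (2*k) *
             of_int (stirling1 l (2*k)) * deg_bernoulli_poly (n - l) lam x)) \<and>
     (\<forall>n\<ge>1.
        deg_sin_bernoulli_poly n lam x y =
          (\<Sum>k=0..n. of_nat (n choose k) * deg_bernoulli k lam * deg_sin_poly (n - k) lam x y) \<and>
        (\<Sum>k=0..n. of_nat (n choose k) * deg_bernoulli k lam * deg_sin_poly (n - k) lam x y) =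
          (\<Sum>k=0..(n - 1) div 2. \<Sum>l=2*k+1..n.
             of_nat (n choose l) * of_real lam ^ (l - 2*k - 1) * (-1) ^ k * of_real y ^ (2*k + 1) *
             of_int (stirling1 l (2*k + 1)) * deg_bernoulli_poly (n - l) lam x)) \<and>
     deg_sin_bernoulli_poly 0 lam x y = 0"
  \<comment> \<open>Each middle equality holds because both sums equal the same polynomial.\<close>
  using deg_cos_bernoulli_poly_conv[of _ lam x y] deg_sin_bernoulli_poly_conv[of _ lam x y]
    deg_cos_bernoulli_poly_stirling1[OF assms, of _ x y]
    deg_sin_bernoulli_poly_stirling1[OF assms, of _ x y] deg_sin_bernoulli_poly_0[OF assms, of x y]
  by (intro conjI allI impI) (simp_all only:)

end
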